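(* If $R\ge R_H$, then for any policy $\bm d\in\mathcal D$ and for each $j=1,2,\dots,m$, the long-run average profit $\eta^{\bm d}$ is strictly monotone increasing with respect to the decision element $d_{n,j}$ on the range $d_{n,j}\in\{0,1,\dots,j\}$ (all other decision elements of $\bm d$ being held fixed).
   Context: Model. Let $n,m\ge1$ be integers and $\lambda>0$, $\mu_1\ge\mu_2>0$. The state space is $\bm\Omega=\{(0,0),(1,0),\dots,(n,0),(n,1),\dots,(n,m)\}$ (in this order). A policy is $\bm d=(0,\dots,0;d_{n,1},\dots,d_{n,m})$ with $d_{n,j}\in\{0,1,\dots,m\}$ (and $d_{i,0}=0$ for $0\le i\le n$); $\mathcal D$ is the set of all policies. Put $\nu(d_{n,j})=n\mu_1+(d_{n,j}\wedge j)\mu_2$ for $1\le j\le m$, where $a\wedge b=\min(a,b)$. $\mathbf B^{(\bm d)}$ is the generator of the birth-death process on $\bm\Omega$ with birth rate $\lambda$ at every state except $(n,m)$ (birth rate $0$ there), death rate $i\mu_1$ at $(i,0)$ for $1\le i\le n$, and death rate $\nu(d_{n,j})$ at $(n,j)$ for $1\le j\le m$. $\bm\pi^{(\bm d)}$ is its unique stationary probability (row) vector. Reward. Let $R\ge 0$ (the service price), $P_{1,W}>0$, $0<P_{2,S}<P_{2,W}$, $C_1>0$, $0\le C_2^{(1)}\le C_2^{(2)}$, $C_3,C_4\ge0$ be constants. For $(i,j)\in\bm\Omega$ put $$A^{(\bm d)}_{i,j}=i\mu_1+(j\wedge d_{i,j})\mu_2,$$ $$B^{(\bm d)}_{i,j}=[nP_{1,W}+d_{i,j}P_{2,W}+(m-d_{i,j})P_{2,S}]C_1+iC_2^{(1)}+jC_2^{(2)}+i\mu_1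 1_{\{j>0\}}C_3+\lambda 1_{\{i=n,j=m\}}C_4 .$$ The reward vector $\bm f^{(\bm d)}$ has entries $f^{(\bm d)}(i,j)=RA^{(\bm d)}_{i,j}-B^{(\bm d)}_{i,j}$, and the long-run average profit is $\eta^{\bm d}=\bm\pi^{(\bm d)}\bm f^{(\bm d)}=RD^{(\bm d)}-F^{(\bm d)}$, where $D^{(\bm d)}=\sum_{(i,j)\in\bm\Omega}\pi^{(\bm d)}(i,j)A^{(\bm d)}_{i,j}$ and $F^{(\bm d)}=\sum_{(i,j)\in\bm\Omega}\pi^{(\bm d)}(i,j)B^{(\bm d)}_{i,j}$. Critical prices. Let $\mathcal B$ be the invertible matrix obtained from $\mathbf B^{(\bm d)}$ by deleting the row and column of state $(0,0)$; its rows and columns are indexed by $\bm\Omega\setminus\{(0,0)\}$. For $0\le j\le m$ let $W^{(\bm d)}_{n,j}$, $V^{(\bm d)}_{n,j}$ and $\gamma^{(\bm d)}_{n,j}$ denote the entries at state $(n,j)$ of, respectively, $(-\mathcal B)^{-1}\bm a$, $(-\mathcal B)^{-1}\bm b$ and $\mu_1(-\mathcal B)^{-1}\bm e_1$, where $\bm a$ has entries $A^{(\bm d)}_{i,j}-D^{(\bm d)}$, $\bm b$ has entries $B^{(\bm d)}_{i,j}-F^{(\bm d)}$ (over $(i,j)\in\bm\Omega\setminus\{(0,0)\}$), and $\bm e_1$ is the unit vector at state $(1,0)$. For $1\le j\le m$ define $$\Re^{(\bm d)}_{n,j}=\frac{[V^{(\bm d)}_{n,j-1}-V^{(\bm d)}_{n,j}]-[\gamma^{(\bm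 d)}_{n,j-1}-\gamma^{(\bm d)}_{n,j}]+\frac{(P_{2,W}-P_{2,S})C_1}{\mu_2}}{1+[W^{(\bm d)}_{n,j-1}-W^{(\bm d)}_{n,j}]},$$ and $$R_H=\max_{\bm d\in\mathcal D}\{0,\Re^{(\bm d)}_{n,1},\dots,\Re^{(\bm d)}_{n,m}\}.$$
   Formalization: Strict increase fails when R equals the critical price of (d,j), possible at R=R_H (profit is then constant in d_{n,j}). Proved: for R≥R_H the profit is nondecreasing on {0,…,j}, and strictly increasing unless R equals that critical price for some value of d_{n,j} in {0,…,j}. *)

theory Defs
  imports
    "Jordan_Normal_Form.Determinant"
    "Jordan_Normal_Form.Gauss_Jordan_Elimination"
    Complex_Main
begin

record dc_model =
  nsrv :: nat             (* n *)
  msrv :: nat             (* m *)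
  arr :: real             (* lambda *)
  serv1 :: real           (* mu_1 *)
  serv2 :: real           (* mu_2 *)
  P1W :: real
  P2S :: real
  P2W :: real
  C1 :: real
  C21 :: real             (* C_2^(1) *)
  C22 :: real             (* C_2^(2) *)
  C3 :: real
  C4 :: real

type_synonym policy = "nat \<times> nat \<Rightarrow> nat"

definition states :: "dc_model \<Rightarrow> (nat \<times> nat) set" where
  "states p = {(i, 0) | i. i \<le> nsrv p} \<union> {(nsrv p, j) | j. 1 \<le> j \<and> j \<le> msrv p}"

text \<open>In the order (0,0), (1,0), ..., (n,0), (n,1), ..., (n,m) the state (i,j) has
  position i + j, counted from 0; \<open>state_at\<close> is the inverse enumeration.
  Vectors and matrices over the state space are indexed by these positions.\<close>

definition state_at :: "dc_model \<Rightarrow> nat \<Rightarrow> nat \<times> nat" where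
  "state_at p k = (min k (nsrv p), k - nsrv p)"

text \<open>Policies are extended by 0 outside the state space, so that two policies
  are equal as soon as they agree on it.\<close>

definition policies :: "dc_model \<Rightarrow> policy set" where
  "policies p = {d. (\<forall>j\<in>{1..msrv p}. d (nsrv p, j) \<in> {0..msrv p}) \<and>
                    (\<forall>i\<in>{0..nsrv p}. d (i, 0) = 0) \<and>
                    (\<forall>s. s \<notin> states p \<longrightarrow> d s = 0)}"

definition nu :: "dc_model \<Rightarrow> policy \<Rightarrow> nat \<Rightarrow> real" where
  "nu p d j = real (nsrv p) * serv1 p + real (min (d (nsrv p, j)) j) * serv2 p"

definition birth_rate :: "dc_model \<Rightarrow> nat \<times> nat \<Rightarrow> real" where
  "birth_rate p s = (if s = (nsrv p, msrv p) then 0 else arr p)"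

definition death_rate :: "dc_model \<Rightarrow> policy \<Rightarrow> nat \<times> nat \<Rightarrow> real" where
  "death_rate p d = (\<lambda>(i, j). if j = 0 then real i * serv1 p else nu p d j)"

definition generator :: "dc_model \<Rightarrow> policy \<Rightarrow> real mat" where
  "generator p d = mat (nsrv p + msrv p + 1) (nsrv p + msrv p + 1) (\<lambda>(k, l).
     if l = k + 1 then birth_rate p (state_at p k)
     else if k = l + 1 then death_rate p d (state_at p k)
     else if k = l then - (birth_rate p (state_at p k) + death_rate p d (state_at p k))
     else 0)"

text \<open>The equation v B = 0 for the row vector v is written with the transpose of B.\<close>

definition stationary :: "dc_model \<Rightarrow> policy \<Rightarrow> real vec" where
  "stationary p d = (THE v. v \<in> carrier_vec (nsrv p + msrv p + 1) \<and>
     (\<forall>k < nsrv p + msrv p + 1. 0 \<le> v $ k) \<and>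
     (\<Sum>k < nsrv p + msrv p + 1. v $ k) = 1 \<and>
     transpose_mat (generator p d) *\<^sub>v v = 0\<^sub>v (nsrv p + msrv p + 1))"

definition pi_at :: "dc_model \<Rightarrow> policy \<Rightarrow> nat \<times> nat \<Rightarrow> real" where
  "pi_at p d = (\<lambda>(i, j). stationary p d $ (i + j))"

definition A_coef :: "dc_model \<Rightarrow> policy \<Rightarrow> nat \<times> nat \<Rightarrow> real" where
  "A_coef p d = (\<lambda>(i, j). real i * serv1 p + real (min j (d (i, j))) * serv2 p)"

definition B_coef :: "dc_model \<Rightarrow> policy \<Rightarrow> nat \<times> nat \<Rightarrow> real" where
  "B_coef p d = (\<lambda>(i, j).
     (real (nsrv p) * P1W p + real (d (i, j)) * P2W p
        + (real (msrv p) - real (d (i, j))) * P2S p) * C1 p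
     + real i * C21 p + real j * C22 p
     + real i * serv1 p * of_bool (j > 0) * C3 p
     + arr p * of_bool (i = nsrv p \<and> j = msrv p) * C4 p)"

definition reward :: "dc_model \<Rightarrow> policy \<Rightarrow> real \<Rightarrow> nat \<times> nat \<Rightarrow> real" where
  "reward p d R s = R * A_coef p d s - B_coef p d s"

definition avg_profit :: "dc_model \<Rightarrow> policy \<Rightarrow> real \<Rightarrow> real" where
  "avg_profit p d R = (\<Sum>s\<in>states p. pi_at p d s * reward p d R s)"

definition D_avg :: "dc_model \<Rightarrow> policy \<Rightarrow> real" where
  "D_avg p d = (\<Sum>s\<in>states p. pi_at p d s * A_coef p d s)"

definition F_avg :: "dc_model \<Rightarrow> policy \<Rightarrow> real" where
  "F_avg p d = (\<Sum>s\<in>states p. pi_at p d s * B_coef p d s)"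

definition red_generator :: "dc_model \<Rightarrow> policy \<Rightarrow> real mat" where
  "red_generator p d = mat_delete (generator p d) 0 0"

definition inv_neg_red :: "dc_model \<Rightarrow> policy \<Rightarrow> real mat" where
  "inv_neg_red p d = the (mat_inverse (- red_generator p d))"

text \<open>Removing (0,0) shifts positions by one: the state (n,j) is at n + j - 1 below.\<close>

definition W_val :: "dc_model \<Rightarrow> policy \<Rightarrow> nat \<Rightarrow> real" where
  "W_val p d j = (inv_neg_red p d *\<^sub>v
     vec (nsrv p + msrv p) (\<lambda>k. A_coef p d (state_at p (k + 1)) - D_avg p d)) $ (nsrv p + j - 1)"

definition V_val :: "dc_model \<Rightarrow> policy \<Rightarrow> nat \<Rightarrow> real" where
  "V_val p d j = (inv_neg_red p d *\<^sub>v
     vec (nsrv p + msrv p) (\<lambda>k. B_coef p d (state_at p (k + 1)) - F_avg p d)) $ (nsrv p + j - 1)"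

definition gamma_val :: "dc_model \<Rightarrow> policy \<Rightarrow> nat \<Rightarrow> real" where
  "gamma_val p d j = (serv1 p \<cdot>\<^sub>v (inv_neg_red p d *\<^sub>v unit_vec (nsrv p + msrv p) 0)) $ (nsrv p + j - 1)"

text \<open>Pitfall: if \<open>d (n, j) \<le> j\<close> and R equals \<open>crit_price p d j\<close> exactly, then the average
  profit does not depend on \<open>d (n, j)\<close> on {0..j}. Hence strict monotonicity does not
  extend to \<open>R = R_H p\<close> for a pair (d, j) at which the maximum \<open>R_H p\<close> is attained.\<close>

definition crit_price :: "dc_model \<Rightarrow> policy \<Rightarrow> nat \<Rightarrow> real" where
  "crit_price p d j =
     ((V_val p d (j - 1) - V_val p d j) - (gamma_val p d (j - 1) - gamma_val p d j)
        + (P2W p - P2S p) * C1 p / serv2 p)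
     / (1 + (W_val p d (j - 1) - W_val p d j))"

definition R_H :: "dc_model \<Rightarrow> real" where
  "R_H p = Max ({0} \<union> {crit_price p d j | d j. d \<in> policies p \<and> j \<in> {1..msrv p}})"

end

theory Submission
  imports Defs
begin

text \<open>Listed by position, the model is a birth-death chain on \<open>0..N\<close>. If \<open>g\<close> solves the Poisson
  equation of a policy \<open>d\<close>, and \<open>d'\<close> differs from \<open>d\<close> only in having \<open>x'\<close> instead of \<open>x\<close> at
  \<open>(n,j)\<close>, then the performance difference formula collapses to the single summand of \<open>(n,j)\<close>:
  a positive multiple of \<open>(x' - x) (1 + W(n,j-1) - W(n,j)) (R - crit_price p d j)\<close>. Here \<open>\<gamma>\<close> drops
  out because it is constantly 1. As the reward \<open>A\<close> is the death rate \<open>\<delta>\<close>, the numbers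
  \<open>h(k) = 1 + W(k-1) - W(k)\<close> satisfy \<open>\<lambda> h(k+1) = \<delta>(k) h(k) + (\<lambda> - D)\<close> with \<open>\<delta>(0) = 0\<close> and
  \<open>D < \<lambda>\<close>; hence they are positive.\<close>

section \<open>Finite birth-death chains\<close>

locale birth_death =
  fixes N :: nat and b \<delta> :: "nat \<Rightarrow> real"
  assumes b_pos: "k < N \<Longrightarrow> 0 < b k" and b_top: "b N = 0"
    and \<delta>_pos: "\<lbrakk>0 < k; k \<le> N\<rbrakk> \<Longrightarrow> 0 < \<delta> k" and \<delta>_0: "\<delta> 0 = 0"
begin

text \<open>The generator acting on functions. As \<open>\<delta> 0 = 0\<close> and
  \<open>b N = 0\<close>, the truncated index \<open>0 - 1\<close> and the index
  \<open>Suc N\<close> are multiplied by 0, so the ends require no separate cases.\<close>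

definition gen :: "(nat \<Rightarrow> real) \<Rightarrow> nat \<Rightarrow> real" where
  "gen g k = b k * (g (Suc k) - g k) + \<delta> k * (g (k - 1) - g k)"

section \<open>Detailed balance and the stationary distribution\<close>

definition balanced :: "(nat \<Rightarrow> real) \<Rightarrow> bool" where
  "balanced v \<longleftrightarrow> (\<forall>k<N. \<delta> (Suc k) * v (Suc k) = b k * v k)"

text \<open>Product-form solution of detailed balance, scaled to the value 1 at state 0.\<close>

definition weight :: "nat \<Rightarrow> real" where
  "weight k = (\<Prod>i<k. b i / \<delta> (Suc i))"

definition stat :: "nat \<Rightarrow> real" where
  "stat k = weight k / (\<Sum>i\<le>N. weight i)"

definition rate_mat :: "real mat" where
  "rate_mat = mat (N + 1) (N + 1) (\<lambda>(k, l).
     if l = k + 1 then b k else if k = l + 1 then \<delta> k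
     else if k = l then - (b k + \<delta> k) else 0)"

lemma weight_pos: "k \<le> N \<Longrightarrow> 0 < weight k"
  unfolding weight_def by (intro prod_pos ballI divide_pos_pos b_pos \<delta>_pos) auto

lemma total_weight_pos: "0 < (\<Sum>i\<le>N. weight i)"
  by (intro sum_pos weight_pos) auto

lemma stat_pos: "k \<le> N \<Longrightarrow> 0 < stat k"
  by (simp add: stat_def weight_pos total_weight_pos)

lemma sum_stat: "(\<Sum>k\<le>N. stat k) = 1"
  using total_weight_pos by (simp add: stat_def flip: sum_divide_distrib)

lemma balanced_stat: "balanced stat"
  unfolding balanced_def
proof (intro allI impI)
  fix k assume "k < N"
  then have "\<delta> (Suc k) \<noteq> 0" using \<delta>_pos[of "Suc k"] by simp
  then show "\<delta> (Suc k) * stat (Suc k) = b k * stat k"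
    by (simp add: stat_def weight_def)
qed

lemma balanced_eq_weight:
  assumes "balanced v" "k \<le> N"
  shows "v k = v 0 * weight k"
  using assms(2)
proof (induction k)
  case 0
  then show ?case by (simp add: weight_def)
next
  case (Suc k)
  then have "\<delta> (Suc k) \<noteq> 0" using \<delta>_pos[of "Suc k"] by simp
  moreover have "\<delta> (Suc k) * v (Suc k) = b k * v k"
    using assms(1) Suc.prems by (simp add: balanced_def)
  ultimately have "v (Suc k) = b k / \<delta> (Suc k) * v k" by (simp add: field_simps)
  also have "v k = v 0 * weight k" using Suc by simp
  finally show ?case by (simp add: weight_def)
qed

lemma balanced_unique:
  assumes "balanced v" "(\<Sum>k\<le>N. v k) = 1" "k \<le> N"
  shows "v k = stat k"
proof -
  have "(\<Sum>k\<le>N. v k) = (\<Sum>k\<le>N. v 0 * weight k)"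
    by (intro sum.cong refl balanced_eq_weight[OF assms(1)]) simp
  then have "v 0 * (\<Sum>k\<le>N. weight k) = 1" using assms(2) by (simp add: sum_distrib_left)
  then have "v 0 = 1 / (\<Sum>k\<le>N. weight k)"
    using total_weight_pos by (simp add: field_simps)
  then show ?thesis using balanced_eq_weight[OF assms(1,3)] by (simp add: stat_def)
qed

section \<open>Stationary means and the Poisson equation\<close>

text \<open>By detailed balance, the downward term at each state cancels the flux left over from the
  state below, so only the flux across the edge above \<open>M\<close> survives.\<close>

lemma sum_balanced_gen_partial:
  assumes "balanced v" "M \<le> N"
  shows "(\<Sum>k\<le>M. v k * gen g k) = v M * b M * (g (Suc M) - g M)"
  using assms(2)
proof (induction M)
  case 0
  then show ?case by (simp add: gen_def \<delta>_0)
next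
  case (Suc M)
  have "\<delta> (Suc M) * v (Suc M) = b M * v M"
    using assms(1) Suc.prems by (simp add: balanced_def)
  moreover have "v (Suc M) * (\<delta> (Suc M) * (g M - g (Suc M))) =
      - (\<delta> (Suc M) * v (Suc M)) * (g (Suc M) - g M)"
    by (simp add: algebra_simps)
  ultimately have "v (Suc M) * (\<delta> (Suc M) * (g M - g (Suc M))) = - (v M * b M * (g (Suc M) - g M))"
    by (simp add: mult.commute)
  then show ?case using Suc by (simp add: gen_def distrib_left)
qed

lemma sum_stat_gen: "(\<Sum>k\<le>N. stat k * gen g k) = 0"
  using sum_balanced_gen_partial[OF balanced_stat order_refl] by (simp add: b_top)

text \<open>The reduced generator yields the Poisson equation only away from 0. The
  \<open>stat\<close>-mean of the defects is 0, so the defect at 0 vanishes too because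
  \<open>stat 0\<close> is positive.\<close>

lemma poisson_everywhere:
  assumes "\<And>k. \<lbrakk>0 < k; k \<le> N\<rbrakk> \<Longrightarrow> gen g k = c - a k"
    and "c = (\<Sum>k\<le>N. stat k * a k)" and "k \<le> N"
  shows "gen g k = c - a k"
proof -
  have "0 = (\<Sum>k\<le>N. stat k * gen g k) + (\<Sum>k\<le>N. stat k * a k) - c * (\<Sum>k\<le>N. stat k)"
    by (simp add: sum_stat_gen sum_stat assms(2))
  also have "\<dots> = (\<Sum>k\<le>N. stat k * (gen g k - (c - a k)))"
    by (simp add: sum_distrib_left algebra_simps sum_subtractf sum.distrib)
  also have "\<dots> = (\<Sum>k\<in>{0}. stat k * (gen g k - (c - a k)))"
    using assms(1) by (intro sum.mono_neutral_right) auto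
  finally have "gen g 0 = c - a 0" using stat_pos[of 0] by simp
  then show ?thesis using assms(1,3) by (cases "k = 0") auto
qed

text \<open>Descend from the top: at \<open>N\<close> there is no birth term, so the last two values
  agree; equality across an edge then removes the birth term at its lower end. This is the trivial
  kernel of the reduced generator.\<close>

lemma gen_eq_0_imp_const:
  assumes "\<And>k. \<lbrakk>0 < k; k \<le> N\<rbrakk> \<Longrightarrow> gen g k = 0" and "k \<le> N"
  shows "g k = g 0"
proof -
  have step: "g (k - 1) = g k" if "0 < k" "k \<le> N" for k
    using that(2,1)
  proof (induction k rule: inc_induct)
    case base
    then show ?case using assms(1)[of N] \<delta>_pos[of N] by (simp add: gen_def b_top)
  next
    case (step k)
    then show ?case using assms(1)[of k] \<delta>_pos[of k] by (simp add: gen_def)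
  qed
  show ?thesis using assms(2) by (induction k) (use step in \<open>force+\<close>)
qed

section \<open>Throughput and positivity of the drops\<close>

text \<open>Balance turns the mean death rate into the rate of accepted arrivals,
  \<open>lam * (1 - stat N)\<close>; blocking at \<open>N\<close> has positive probability.\<close>

lemma throughput_lt:
  assumes "0 < N" "\<And>k. k < N \<Longrightarrow> b k = lam"
  shows "(\<Sum>k\<le>N. stat k * \<delta> k) < lam"
proof -
  obtain M where M: "N = Suc M" using assms(1) gr0_conv_Suc by blast
  have lam: "0 < lam" using assms b_pos by metis
  have "(\<Sum>k\<le>N. stat k * \<delta> k) = (\<Sum>k\<le>M. stat (Suc k) * \<delta> (Suc k))"
    by (simp only: M sum.atMost_Suc_shift) (simp add: \<delta>_0)
  also have "\<dots> = (\<Sum>k\<le>M. lam * stat k)"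
  proof (intro sum.cong refl)
    fix k assume "k \<in> {..M}"
    then have "k < N" using M by simp
    then show "stat (Suc k) * \<delta> (Suc k) = lam * stat k"
      using balanced_stat assms(2)[of k] by (simp add: balanced_def mult.commute)
  qed
  also have "\<dots> = lam * (1 - stat N)"
    using sum_stat by (simp add: M flip: sum_distrib_left)
  also have "\<dots> < lam" using stat_pos[of N] lam by (simp add: algebra_simps)
  finally show ?thesis .
qed

lemma one_plus_drop_pos:
  assumes "0 < N" "\<And>k. k < N \<Longrightarrow> b k = lam"
    and "\<And>k. k \<le> N \<Longrightarrow> gen w k = (\<Sum>k\<le>N. stat k * \<delta> k) - \<delta> k" and "k < N"
  shows "0 < 1 + (w k - w (Suc k))"
  using assms(4)
proof (induction k)
  case 0
  have "lam * (1 + (w 0 - w (Suc 0))) = lam - (\<Sum>k\<le>N. stat k * \<delta> k)"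
    using assms(3)[of 0] assms(2)[OF 0] by (simp add: gen_def \<delta>_0 algebra_simps)
  then have "0 < lam * (1 + (w 0 - w (Suc 0)))" using throughput_lt[OF assms(1,2)] by simp
  then show ?case using b_pos[OF 0] assms(2)[OF 0] by (simp add: zero_less_mult_iff)
next
  case (Suc k)
  let ?D = "\<Sum>k\<le>N. stat k * \<delta> k"
  \<comment> \<open>The Poisson equation at \<open>Suc k\<close> with \<open>lam\<close> added: the
    reward \<open>\<delta> (Suc k)\<close> supplies the summand 1 beside the lower drop.\<close>
  have "lam * (1 + (w (Suc k) - w (Suc (Suc k)))) = \<delta> (Suc k) * (1 + (w k - w (Suc k))) + (lam - ?D)"
    using assms(3)[of "Suc k"] assms(2)[OF Suc.prems] Suc.prems by (simp add: gen_def algebra_simps)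
  moreover have "0 < \<delta> (Suc k) * (1 + (w k - w (Suc k)))"
    using Suc \<delta>_pos[of "Suc k"] by simp
  ultimately have "0 < lam * (1 + (w (Suc k) - w (Suc (Suc k))))"
    using throughput_lt[OF assms(1,2)] by simp
  then show ?case using b_pos[OF Suc.prems] assms(2)[OF Suc.prems] by (simp add: zero_less_mult_iff)
qed

section \<open>Matrix form of the generator\<close>

lemma rate_mat_carrier [simp]: "rate_mat \<in> carrier_mat (N + 1) (N + 1)"
  by (simp add: rate_mat_def)

lemma rate_mat_row:
  assumes "k \<le> N"
  shows "(\<Sum>l<N + 1. rate_mat $$ (k, l) * g l) = gen g k"
proof -
  \<comment> \<open>At \<open>k = 0\<close> the indices \<open>k - 1\<close> and \<open>k\<close>
    coincide, but the extra summand carries the factor \<open>\<delta> 0 = 0\<close>.\<close>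
  have "(\<Sum>l<N + 1. rate_mat $$ (k, l) * g l) =
    (\<Sum>l<N + 1. (if l = k + 1 then b k * g l else 0) + (if l = k - 1 then \<delta> k * g l else 0)
       + (if l = k then - (b k + \<delta> k) * g l else 0))"
    using assms by (intro sum.cong) (auto simp: rate_mat_def \<delta>_0)
  also have "\<dots> = (if k < N then b k * g (k + 1) else 0) + \<delta> k * g (k - 1) - (b k + \<delta> k) * g k"
    using assms by (simp only: sum.distrib sum.delta finite_lessThan) (auto simp: algebra_simps)
  also have "\<dots> = gen g k"
    using assms b_top by (cases "k = N") (auto simp: gen_def algebra_simps)
  finally show ?thesis .
qed

text \<open>Grouping a column by the imbalances on the edges above and below \<open>l\<close> allows
  global balance to be solved edge by edge; an edge missing at an end counts as 0.\<close>

lemma rate_mat_column: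
  assumes "l \<le> N"
  shows "(\<Sum>k<N + 1. rate_mat $$ (k, l) * v k) =
    (if l < N then \<delta> (Suc l) * v (Suc l) - b l * v l else 0)
    - (if 0 < l then \<delta> l * v l - b (l - 1) * v (l - 1) else 0)"
proof -
  have "(\<Sum>k<N + 1. rate_mat $$ (k, l) * v k) =
    (\<Sum>k<N + 1. (if k = l - 1 then (if 0 < l then b k * v k else 0) else 0)
       + (if k = Suc l then \<delta> k * v k else 0)
       + (if k = l then - (b k + \<delta> k) * v k else 0))"
    using assms by (intro sum.cong) (auto simp: rate_mat_def)
  also have "\<dots> = (if 0 < l then b (l - 1) * v (l - 1) else 0)
      + (if l < N then \<delta> (Suc l) * v (Suc l) else 0) - (b l + \<delta> l) * v l"
    using assms by (simp only: sum.distrib sum.delta finite_lessThan) (auto simp: algebra_simps)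
  also have "\<dots> = (if l < N then \<delta> (Suc l) * v (Suc l) - b l * v l else 0)
    - (if 0 < l then \<delta> l * v l - b (l - 1) * v (l - 1) else 0)"
    using assms b_top \<delta>_0 by (cases "l = N"; cases "l = 0") (auto simp: algebra_simps)
  finally show ?thesis .
qed

text \<open>On a line, global balance is detailed balance: the equation at 0 involves only the first
  edge, and each further one passes balance to the next edge.\<close>

lemma transpose_rate_mat_eq_0_iff:
  assumes "v \<in> carrier_vec (N + 1)"
  shows "transpose_mat rate_mat *\<^sub>v v = 0\<^sub>v (N + 1) \<longleftrightarrow> balanced (($) v)"
proof -
  have entry: "(transpose_mat rate_mat *\<^sub>v v) $ l = (\<Sum>k<N + 1. rate_mat $$ (k, l) * v $ k)"
    if "l \<le> N" for l
    using assms that rate_mat_carrier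
    by (auto simp: scalar_prod_def lessThan_atLeast0 intro!: sum.cong)
  have "transpose_mat rate_mat *\<^sub>v v = 0\<^sub>v (N + 1) \<longleftrightarrow>
    (\<forall>l\<le>N. (transpose_mat rate_mat *\<^sub>v v) $ l = 0)"
    using assms rate_mat_carrier by (auto simp: vec_eq_iff less_Suc_eq_le)
  also have "\<dots> \<longleftrightarrow> balanced (($) v)"
  proof
    assume eqs: "\<forall>l\<le>N. (transpose_mat rate_mat *\<^sub>v v) $ l = 0"
    have "\<delta> (Suc k) * v $ Suc k - b k * v $ k = 0" if "k < N" for k
      using that
    proof (induction k)
      case 0
      then show ?case using eqs[rule_format, of 0] entry[of 0] rate_mat_column[of 0 "($) v"] by simp
    next
      case (Suc k)
      then show ?case
        using eqs[rule_format, of "Suc k"] entry[of "Suc k"] rate_mat_column[of "Suc k" "($) v"] by simp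
    qed
    then show "balanced (($) v)" by (simp add: balanced_def)
  next
    assume "balanced (($) v)"
    then have bal: "\<And>k. k < N \<Longrightarrow> \<delta> (Suc k) * v $ Suc k = b k * v $ k" by (simp add: balanced_def)
    show "\<forall>l\<le>N. (transpose_mat rate_mat *\<^sub>v v) $ l = 0"
    proof (intro allI impI)
      fix l assume "l \<le> N"
      then show "(transpose_mat rate_mat *\<^sub>v v) $ l = 0"
        using bal[of l] bal[of "l - 1"] by (simp only: entry rate_mat_column) auto
    qed
  qed
  finally show ?thesis .
qed

lemma the_stationary_eq_stat:
  "(THE v. v \<in> carrier_vec (N + 1) \<and> (\<forall>k < N + 1. 0 \<le> v $ k) \<and> (\<Sum>k < N + 1. v $ k) = 1 \<and>
     transpose_mat rate_mat *\<^sub>v v = 0\<^sub>v (N + 1)) = vec (N + 1) stat" (is "The ?P = ?s")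
proof (rule the_equality)
  have "balanced (($) ?s)" using balanced_stat by (auto simp: balanced_def)
  moreover have "(\<Sum>k < N + 1. ?s $ k) = 1"
    using sum_stat by (simp add: lessThan_Suc_atMost del: sum.lessThan_Suc)
  moreover have "0 \<le> ?s $ k" if "k < N + 1" for k
    using that stat_pos[of k] by simp
  ultimately show "?P ?s"
    using transpose_rate_mat_eq_0_iff[of ?s] by (simp only: vec_carrier) blast
next
  fix v assume v: "?P v"
  then have "balanced (($) v)" using transpose_rate_mat_eq_0_iff[of v] by blast
  moreover have "(\<Sum>k\<le>N. v $ k) = 1"
    using v by (simp add: lessThan_Suc_atMost del: sum.lessThan_Suc)
  ultimately have "v $ k = stat k" if "k \<le> N" for k using balanced_unique that by blast
  then show "v = ?s" using v by (auto simp: less_Suc_eq_le)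
qed

section \<open>The reduced generator and its inverse\<close>

text \<open>Extension by 0 at the deleted state: removing state 0 from the generator amounts to
  normalising functions to vanish there.\<close>

definition shifted :: "real vec \<Rightarrow> nat \<Rightarrow> real" where
  "shifted x k = (if k = 0 then 0 else x $ (k - 1))"

lemma reduced_carrier: "mat_delete rate_mat 0 0 \<in> carrier_mat N N"
  using mat_delete_carrier[OF rate_mat_carrier] by simp

lemma reduced_mult_vec:
  assumes "x \<in> carrier_vec N" "k < N"
  shows "(mat_delete rate_mat 0 0 *\<^sub>v x) $ k = gen (shifted x) (Suc k)"
proof -
  have "(mat_delete rate_mat 0 0 *\<^sub>v x) $ k = (\<Sum>l<N. rate_mat $$ (Suc k, Suc l) * x $ l)"
    using assms reduced_carrier
    by (auto simp: scalar_prod_def lessThan_atLeast0 mat_delete_def rate_mat_def intro!: sum.cong)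
  also have "\<dots> = (\<Sum>l<N + 1. rate_mat $$ (Suc k, l) * shifted x l)"
    by (simp add: sum.lessThan_Suc_shift shifted_def del: sum.lessThan_Suc)
  also have "\<dots> = gen (shifted x) (Suc k)" using assms by (intro rate_mat_row) simp
  finally show ?thesis .
qed

lemma neg_reduced_mult_vec:
  assumes "x \<in> carrier_vec N" "k < N"
  shows "(- mat_delete rate_mat 0 0 *\<^sub>v x) $ k = - gen (shifted x) (Suc k)"
proof -
  have "- mat_delete rate_mat 0 0 *\<^sub>v x = - (mat_delete rate_mat 0 0 *\<^sub>v x)"
    using carrier_vecD[OF assms(1)] carrier_matD[OF reduced_carrier]
    by (intro uminus_mult_mat_vec) simp
  then have "(- mat_delete rate_mat 0 0 *\<^sub>v x) $ k = - (mat_delete rate_mat 0 0 *\<^sub>v x) $ k"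
    using assms(2) carrier_matD[OF reduced_carrier] by simp
  then show ?thesis using assms by (simp add: reduced_mult_vec)
qed

text \<open>A kernel vector extends to a function that \<open>gen\<close> annihilates away from 0.
  Such a function is constant, and its value at 0 is 0.\<close>

lemma mat_inverse_neg_reduced:
  obtains J where "mat_inverse (- mat_delete rate_mat 0 0) = Some J" "J \<in> carrier_mat N N"
    "- mat_delete rate_mat 0 0 * J = 1\<^sub>m N" "J * - mat_delete rate_mat 0 0 = 1\<^sub>m N"
proof -
  let ?M = "- mat_delete rate_mat 0 0"
  have M: "?M \<in> carrier_mat N N" using reduced_carrier by simp
  have "x = 0\<^sub>v N" if x: "x \<in> carrier_vec N" "?M *\<^sub>v x = 0\<^sub>v N" for x
  proof -
    have "gen (shifted x) k = 0" if "0 < k" "k \<le> N" for k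
    proof -
      have "(?M *\<^sub>v x) $ (k - 1) = 0" using x(2) that by simp
      then show ?thesis using neg_reduced_mult_vec[OF x(1), of "k - 1"] that by simp
    qed
    then have "shifted x k = 0" if "k \<le> N" for k
      using gen_eq_0_imp_const that by (metis shifted_def)
    then have "x $ k = 0" if "k < N" for k
      using that by (metis Suc_leI diff_Suc_1 nat.distinct(1) shifted_def)
    then show ?thesis using x(1) by auto
  qed
  then have "det ?M \<noteq> 0" using det_0_iff_vec_prod_zero_field[OF M] by blast
  then have unit: "?M \<in> Units (ring_mat TYPE(real) N ())" using det_non_zero_imp_unit[OF M] by simp
  then obtain J where J: "mat_inverse ?M = Some J"
    using mat_inverse(1)[OF M, of "()"] by (cases "mat_inverse ?M") auto
  show ?thesis using that[OF J] mat_inverse(2)[OF M J] by blast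
qed

definition inv_red :: "real mat" where
  "inv_red = the (mat_inverse (- mat_delete rate_mat 0 0))"

lemma inv_red_carrier: "inv_red \<in> carrier_mat N N"
  by (rule mat_inverse_neg_reduced) (simp add: inv_red_def)

text \<open>For a centred reward vector \<open>x\<close> this is the Poisson equation at the states
  other than 0.\<close>

lemma gen_shifted_inv_red:
  assumes "x \<in> carrier_vec N" "0 < k" "k \<le> N"
  shows "gen (shifted (inv_red *\<^sub>v x)) k = - x $ (k - 1)"
proof -
  let ?M = "mat_delete rate_mat 0 0"
  have inv: "- ?M * inv_red = 1\<^sub>m N" by (rule mat_inverse_neg_reduced) (simp add: inv_red_def)
  have y: "inv_red *\<^sub>v x \<in> carrier_vec N" by (rule mult_mat_vec_carrier[OF inv_red_carrier assms(1)])
  have M: "- ?M \<in> carrier_mat N N" using reduced_carrier by simp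
  have "- ?M *\<^sub>v (inv_red *\<^sub>v x) = (- ?M * inv_red) *\<^sub>v x"
    by (rule assoc_mult_mat_vec[OF M inv_red_carrier assms(1), symmetric])
  also have "\<dots> = x" by (simp only: inv one_mult_mat_vec[OF assms(1)])
  finally have "(- ?M *\<^sub>v (inv_red *\<^sub>v x)) $ (k - 1) = x $ (k - 1)" by (rule arg_cong)
  then show ?thesis using neg_reduced_mult_vec[OF y, of "k - 1"] assms by simp
qed

text \<open>Generator rows sum to 0, so the reduced rows applied to the all-ones vector leave only
  the rate from state 1 into the deleted state; inverting gives back the all-ones vector.\<close>

lemma inv_red_unit_vec:
  assumes "k < N"
  shows "(\<delta> 1 \<cdot>\<^sub>v (inv_red *\<^sub>v unit_vec N 0)) $ k = 1"
proof -
  let ?M = "mat_delete rate_mat 0 0"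
  let ?e = "\<delta> 1 \<cdot>\<^sub>v unit_vec N 0" and ?one = "vec N (\<lambda>_. 1)"
  have inv: "inv_red * - ?M = 1\<^sub>m N" by (rule mat_inverse_neg_reduced) (simp add: inv_red_def)
  have M: "- ?M \<in> carrier_mat N N" using reduced_carrier by simp
  have "- ?M *\<^sub>v ?one = ?e"
  proof (rule eq_vecI)
    fix i assume "i < dim_vec ?e"
    then have i: "i < N" by simp
    have "(- ?M *\<^sub>v ?one) $ i = - gen (shifted ?one) (Suc i)"
      using i by (intro neg_reduced_mult_vec) simp_all
    \<comment> \<open>At the top state \<open>shifted ?one\<close> is read past the end of the
      vector, with factor \<open>b N = 0\<close>.\<close>
    also have "\<dots> = ?e $ i"
      using i b_top by (cases "Suc i = N") (auto simp: gen_def shifted_def)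
    finally show "(- ?M *\<^sub>v ?one) $ i = ?e $ i" .
  qed (use reduced_carrier in auto)
  then have "inv_red *\<^sub>v ?e = inv_red *\<^sub>v (- ?M *\<^sub>v ?one)" by (rule arg_cong[OF sym])
  also have "\<dots> = (inv_red * - ?M) *\<^sub>v ?one"
    by (rule assoc_mult_mat_vec[OF inv_red_carrier M vec_carrier, symmetric])
  also have "\<dots> = ?one" by (simp only: inv one_mult_mat_vec[OF vec_carrier])
  finally have "inv_red *\<^sub>v ?e = ?one" .
  moreover have "inv_red *\<^sub>v ?e = \<delta> 1 \<cdot>\<^sub>v (inv_red *\<^sub>v unit_vec N 0)"
    using inv_red_carrier by (intro mult_mat_vec) auto
  ultimately show ?thesis using assms by (metis index_vec)
qed

end

text \<open>The mean of \<open>new.gen g\<close> under the new stationary law is 0. Adding it and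
  inserting the old Poisson equation cancels the common birth terms and leaves only the changes in
  rewards and death rates.\<close>

lemma performance_difference:
  assumes "birth_death N b \<delta>" "birth_death N b \<delta>'" "i \<le> N"
    and poisson: "\<And>k. k \<le> N \<Longrightarrow> birth_death.gen b \<delta> g k = c - f k"
    and same: "\<And>k. \<lbrakk>k \<le> N; k \<noteq> i\<rbrakk> \<Longrightarrow> \<delta>' k = \<delta> k" "\<And>k. \<lbrakk>k \<le> N; k \<noteq> i\<rbrakk> \<Longrightarrow> f' k = f k"
  shows "(\<Sum>k\<le>N. birth_death.stat N b \<delta>' k * f' k) - c =
    birth_death.stat N b \<delta>' i * (f' i - f i + (\<delta>' i - \<delta> i) * (g (i - 1) - g i))"
proof -
  interpret old: birth_death N b \<delta> by fact
  interpret new: birth_death N b \<delta>' by fact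
  have "(\<Sum>k\<le>N. new.stat k * f' k) - c =
      (\<Sum>k\<le>N. new.stat k * f' k) - c * (\<Sum>k\<le>N. new.stat k) + (\<Sum>k\<le>N. new.stat k * new.gen g k)"
    by (simp add: new.sum_stat new.sum_stat_gen)
  also have "\<dots> = (\<Sum>k\<le>N. new.stat k * (f' k - c + new.gen g k))"
    by (simp add: sum_distrib_left algebra_simps sum_subtractf sum.distrib)
  also have "\<dots> = (\<Sum>k\<le>N. new.stat k * (f' k - f k + (\<delta>' k - \<delta> k) * (g (k - 1) - g k)))"
  proof (intro sum.cong refl arg_cong2[of _ _ _ _ "(*)"])
    fix k assume "k \<in> {..N}"
    then have "c = old.gen g k + f k" using poisson[of k] by simp
    then show "f' k - c + new.gen g k = f' k - f k + (\<delta>' k - \<delta> k) * (g (k - 1) - g k)"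
      by (simp add: new.gen_def old.gen_def algebra_simps)
  qed
  also have "\<dots> = (\<Sum>k\<in>{i}. new.stat k * (f' k - f k + (\<delta>' k - \<delta> k) * (g (k - 1) - g k)))"
    using assms(3) same by (intro sum.mono_neutral_right) auto
  finally show ?thesis by simp
qed

section \<open>The data center\<close>

locale data_center =
  fixes p :: dc_model
  assumes n_pos: "1 \<le> nsrv p" and m_pos: "1 \<le> msrv p"
    and arr_pos: "0 < arr p" and serv1_pos: "0 < serv1 p" and serv2_pos: "0 < serv2 p"
begin

abbreviation top_pos :: nat where "top_pos \<equiv> nsrv p + msrv p"

abbreviation birth :: "nat \<Rightarrow> real" where
  "birth k \<equiv> birth_rate p (state_at p k)"

abbreviation death :: "policy \<Rightarrow> nat \<Rightarrow> real" where
  "death d k \<equiv> death_rate p d (state_at p k)"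

lemma birth_below: "k < top_pos \<Longrightarrow> birth k = arr p"
  using m_pos by (auto simp: birth_rate_def state_at_def)

text \<open>One chain for each policy: \<open>d\<close> remains a parameter so that two policies can
  be compared.\<close>

sublocale chain: birth_death top_pos birth "death d" for d
proof
  show "0 < birth k" if "k < top_pos" for k using that arr_pos by (simp add: birth_below)
  show "birth top_pos = 0" by (simp add: birth_rate_def state_at_def)
  \<comment> \<open>Even with decision 0 the rate at \<open>(n, j)\<close> is at least
    \<open>n\<close> times \<open>serv1 p\<close>, and \<open>n\<close> is positive.\<close>
  show "0 < death d k" if "0 < k" "k \<le> top_pos" for k
    using that n_pos serv1_pos serv2_pos
    by (auto simp: death_rate_def state_at_def nu_def intro!: add_pos_nonneg mult_pos_pos)
  show "death d 0 = 0" by (simp add: death_rate_def state_at_def)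
qed

lemma generator_eq: "generator p d = chain.rate_mat d"
  by (simp add: generator_def chain.rate_mat_def)

lemma stationary_eq: "stationary p d = vec (top_pos + 1) (chain.stat d)"
  unfolding stationary_def generator_eq by (rule chain.the_stationary_eq_stat)

lemma sum_states: "(\<Sum>s\<in>states p. pi_at p d s * F s) = (\<Sum>k\<le>top_pos. chain.stat d k * F (state_at p k))"
proof -
  have "bij_betw (state_at p) {..top_pos} (states p)"
    by (rule bij_betw_byWitness[where f' = "\<lambda>(i, j). i + j"])
      (auto simp: state_at_def states_def)
  then have "(\<Sum>s\<in>states p. pi_at p d s * F s) =
      (\<Sum>k\<le>top_pos. pi_at p d (state_at p k) * F (state_at p k))"
    by (rule sum.reindex_bij_betw[symmetric])
  also have "\<dots> = (\<Sum>k\<le>top_pos. chain.stat d k * F (state_at p k))"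
    by (intro sum.cong) (auto simp: pi_at_def state_at_def stationary_eq min_def)
  finally show ?thesis .
qed

lemma A_coef_eq_death: "A_coef p d (state_at p k) = death d k"
  by (auto simp: A_coef_def death_rate_def nu_def state_at_def min.commute)

section \<open>Poisson solutions behind the critical prices\<close>

definition W_fun :: "policy \<Rightarrow> nat \<Rightarrow> real" where
  "W_fun d = chain.shifted (inv_neg_red p d *\<^sub>v
     vec top_pos (\<lambda>k. A_coef p d (state_at p (k + 1)) - D_avg p d))"

definition V_fun :: "policy \<Rightarrow> nat \<Rightarrow> real" where
  "V_fun d = chain.shifted (inv_neg_red p d *\<^sub>v
     vec top_pos (\<lambda>k. B_coef p d (state_at p (k + 1)) - F_avg p d))"

text \<open>Entry \<open>n + j - 1\<close> of the reduced vector belongs to position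
  \<open>n + j\<close>, which is never the deleted position 0 because
  \<open>n \<ge> 1\<close>.\<close>

lemma W_val_eq: "W_val p d j = W_fun d (nsrv p + j)"
  using n_pos by (simp add: W_val_def W_fun_def chain.shifted_def)

lemma V_val_eq: "V_val p d j = V_fun d (nsrv p + j)"
  using n_pos by (simp add: V_val_def V_fun_def chain.shifted_def)

lemma inv_neg_red_eq: "inv_neg_red p d = chain.inv_red d"
  by (simp add: inv_neg_red_def red_generator_def generator_eq chain.inv_red_def)

lemma gamma_val_eq_1: "j \<le> msrv p \<Longrightarrow> gamma_val p d j = 1"
proof -
  assume "j \<le> msrv p"
  \<comment> \<open>Position 1 is the state \<open>(1, 0)\<close>, so the factor in
    \<open>gamma_val\<close> is exactly the rate into the deleted state.\<close>
  moreover have "death d 1 = serv1 p" using n_pos by (simp add: death_rate_def state_at_def)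
  ultimately show ?thesis
    using chain.inv_red_unit_vec[of "nsrv p + j - 1" d] n_pos
    by (simp add: gamma_val_def inv_neg_red_eq)
qed

lemma gen_W: "k \<le> top_pos \<Longrightarrow> chain.gen d (W_fun d) k = D_avg p d - A_coef p d (state_at p k)"
  by (rule chain.poisson_everywhere)
    (auto simp: W_fun_def inv_neg_red_eq chain.gen_shifted_inv_red D_avg_def sum_states)

lemma gen_V: "k \<le> top_pos \<Longrightarrow> chain.gen d (V_fun d) k = F_avg p d - B_coef p d (state_at p k)"
  by (rule chain.poisson_everywhere)
    (auto simp: V_fun_def inv_neg_red_eq chain.gen_shifted_inv_red F_avg_def sum_states)

lemma denominator_pos:
  assumes "j \<in> {1..msrv p}"
  shows "0 < 1 + (W_val p d (j - 1) - W_val p d j)"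
proof -
  have "0 < 1 + (W_fun d (nsrv p + j - 1) - W_fun d (Suc (nsrv p + j - 1)))"
  proof (rule chain.one_plus_drop_pos[OF _ birth_below])
    show "chain.gen d (W_fun d) k = (\<Sum>k\<le>top_pos. chain.stat d k * death d k) - death d k"
      if "k \<le> top_pos" for k
      using gen_W[OF that, of d] by (simp add: A_coef_eq_death D_avg_def sum_states)
  qed (use n_pos assms in auto)
  then show ?thesis using assms by (simp add: W_val_eq)
qed

text \<open>By linearity, the solutions for \<open>A\<close> and \<open>B\<close> combine into one
  for the reward \<open>R * A - B\<close>, whose mean is the profit.\<close>

lemma gen_profit:
  assumes "k \<le> top_pos"
  shows "chain.gen d (\<lambda>k. R * W_fun d k - V_fun d k) k = avg_profit p d R - reward p d R (state_at p k)"
proof -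
  have "chain.gen d (\<lambda>k. R * W_fun d k - V_fun d k) k =
      R * chain.gen d (W_fun d) k - chain.gen d (V_fun d) k"
    by (simp add: chain.gen_def algebra_simps)
  also have "\<dots> = R * D_avg p d - F_avg p d - reward p d R (state_at p k)"
    by (simp add: gen_W[OF assms] gen_V[OF assms] reward_def algebra_simps)
  also have "R * D_avg p d - F_avg p d = avg_profit p d R"
    by (simp add: D_avg_def F_avg_def avg_profit_def reward_def sum_distrib_left
        algebra_simps flip: sum_subtractf)
  finally show ?thesis .
qed

section \<open>Changing a single decision\<close>

text \<open>The critical price is the zero in \<open>R\<close> of the performance difference. It is
  taken at the old policy \<open>dx\<close>, whereas the stationary weight belongs to
  \<open>dy\<close>.\<close>

lemma avg_profit_difference:
  fixes d :: policy
  assumes j: "j \<in> {1..msrv p}" and "x \<le> j" "y \<le> j"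
  defines "dx \<equiv> d((nsrv p, j) := x)" and "dy \<equiv> d((nsrv p, j) := y)"
  shows "avg_profit p dy R - avg_profit p dx R =
    chain.stat dy (nsrv p + j) * serv2 p * (real y - real x)
      * (1 + (W_val p dx (j - 1) - W_val p dx j)) * (R - crit_price p dx j)"
proof -
  let ?i = "nsrv p + j" and ?c = "(P2W p - P2S p) * C1 p"
  let ?h = "1 + (W_val p dx (j - 1) - W_val p dx j)" and ?V = "V_val p dx (j - 1) - V_val p dx j"
  let ?g = "\<lambda>k. R * W_fun dx k - V_fun dx k"
  have other: "state_at p k \<noteq> (nsrv p, j)" if "k \<noteq> ?i" for k
    using that j by (auto simp: state_at_def min_def split: if_splits)
  have state: "state_at p ?i = (nsrv p, j)" using j by (simp add: state_at_def)
  have death_same: "death dy k = death dx k" if "k \<noteq> ?i" for k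
    using other[OF that] j by (auto simp: death_rate_def nu_def dx_def dy_def state_at_def)
  have reward_same: "reward p dy R (state_at p k) = reward p dx R (state_at p k)" if "k \<noteq> ?i" for k
    using other[OF that] by (auto simp: reward_def A_coef_def B_coef_def dx_def dy_def split: prod.split)
  have "avg_profit p dy R - avg_profit p dx R =
      chain.stat dy ?i * (reward p dy R (state_at p ?i) - reward p dx R (state_at p ?i)
        + (death dy ?i - death dx ?i) * (?g (?i - 1) - ?g ?i))"
    unfolding avg_profit_def[of _ dy] sum_states
    by (rule performance_difference[OF chain.birth_death_axioms chain.birth_death_axioms _ gen_profit])
      (use j death_same reward_same in auto)
  \<comment> \<open>With both decisions at most \<open>j\<close>, the minimum with \<open>j\<close>
    is the decision itself.\<close>
  also have "death dy ?i - death dx ?i = (real y - real x) * serv2 p"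
    unfolding state using j assms(2,3) by (simp add: death_rate_def nu_def dx_def dy_def algebra_simps)
  also have "reward p dy R (state_at p ?i) - reward p dx R (state_at p ?i) =
      (real y - real x) * (R * serv2 p - ?c)"
    unfolding state using assms(2,3)
    by (simp add: reward_def A_coef_def B_coef_def dx_def dy_def algebra_simps)
  also have "?g (?i - 1) - ?g ?i = R * (?h - 1) - ?V"
    using j by (simp add: W_val_eq V_val_eq algebra_simps)
  \<comment> \<open>\<open>R\<close> enters through the direct reward and through \<open>W\<close>;
    together its coefficient is \<open>serv2 p * ?h\<close>, the origin of the summand 1 in the
    denominator.\<close>
  also have "chain.stat dy ?i * ((real y - real x) * (R * serv2 p - ?c)
        + (real y - real x) * serv2 p * (R * (?h - 1) - ?V)) =
      chain.stat dy ?i * serv2 p * (real y - real x) * (?h * R - (?V + ?c / serv2 p))"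
    using serv2_pos by (simp add: field_simps)
  also have "?V + ?c / serv2 p = ?h * crit_price p dx j"
  proof -
    have "gamma_val p dx (j - 1) - gamma_val p dx j = 0"
      using j by (auto simp: gamma_val_eq_1)
    then show ?thesis using denominator_pos[OF j, of dx] by (simp add: crit_price_def)
  qed
  finally show ?thesis by (simp add: algebra_simps)
qed

text \<open>Policies are 0 off the finite state space, so there are finitely many and
  \<open>R_H\<close> is a genuine maximum.\<close>

lemma finite_policies: "finite (policies p)"
proof (rule finite_subset)
  have "finite (states p)"
    by (rule finite_subset[of _ "{..nsrv p} \<times> {..msrv p}"]) (auto simp: states_def)
  then show "finite {d. \<forall>s. (s \<in> states p \<longrightarrow> d s \<in> {0..msrv p}) \<and> (s \<notin> states p \<longrightarrow> d s = 0)}"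
    by (intro finite_set_of_finite_funs) auto
  show "policies p \<subseteq> {d. \<forall>s. (s \<in> states p \<longrightarrow> d s \<in> {0..msrv p}) \<and> (s \<notin> states p \<longrightarrow> d s = 0)}"
    by (auto simp: policies_def states_def)
qed

lemma crit_price_le_R_H:
  assumes "d \<in> policies p" "j \<in> {1..msrv p}"
  shows "crit_price p d j \<le> R_H p"
proof -
  have "{crit_price p d j | d j. d \<in> policies p \<and> j \<in> {1..msrv p}} =
      (\<lambda>(d, j). crit_price p d j) ` (policies p \<times> {1..msrv p})" by force
  then have "finite {crit_price p d j | d j. d \<in> policies p \<and> j \<in> {1..msrv p}}"
    using finite_policies by simp
  then show ?thesis unfolding R_H_def using assms by (intro Max_ge) auto
qed

end

text \<open>If \<open>R\<close> equals the critical price of some \<open>d((n, j) := x)\<close> with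
  \<open>x \<le> j\<close>, the difference formula makes the profit constant on
  \<open>{0..j}\<close>; \<open>R_H p \<le> R\<close> allows this when \<open>R_H p\<close> is
  attained there. Hence monotonicity is asserted in general and strictness away from these prices,
  in particular for \<open>R_H p < R\<close>.\<close>

theorem theorem4:
  fixes p :: dc_model and R :: real and d :: policy and j :: nat
  assumes "1 \<le> nsrv p" and "1 \<le> msrv p"
    and "0 < arr p" and "serv2 p \<le> serv1 p" and "0 < serv2 p"
    and "0 < P1W p" and "0 < P2S p" and "P2S p < P2W p"
    and "0 < C1 p" and "0 \<le> C21 p" and "C21 p \<le> C22 p" and "0 \<le> C3 p" and "0 \<le> C4 p"
    and "0 \<le> R" and "R_H p \<le> R"
    and "d \<in> policies p" and "j \<in> {1..msrv p}"
  shows "mono_on {0..j} (\<lambda>x. avg_profit p (d((nsrv p, j) := x)) R) \<and>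
    ((\<forall>x\<in>{0..j}. R \<noteq> crit_price p (d((nsrv p, j) := x)) j) \<longrightarrow>
      strict_mono_on {0..j} (\<lambda>x. avg_profit p (d((nsrv p, j) := x)) R))"
proof -
  interpret data_center p using assms by unfold_locales auto
  let ?d = "\<lambda>x. d((nsrv p, j) := x)"
  let ?\<eta> = "\<lambda>x. avg_profit p (?d x) R"
  have diff: "\<exists>c>0. ?\<eta> y - ?\<eta> x = c * (real y - real x) * (R - crit_price p (?d x) j)"
    if "x \<le> j" "y \<le> j" for x y
  proof (intro exI conjI)
    let ?c = "chain.stat (?d y) (nsrv p + j) * serv2 p
      * (1 + (W_val p (?d x) (j - 1) - W_val p (?d x) j))"
    show "0 < ?c"
      using chain.stat_pos serv2_pos denominator_pos assms(17) by (intro mult_pos_pos) auto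
    show "?\<eta> y - ?\<eta> x = ?c * (real y - real x) * (R - crit_price p (?d x) j)"
      using avg_profit_difference[OF assms(17) that] by (simp add: mult_ac)
  qed
  have crit: "crit_price p (?d x) j \<le> R" if "x \<le> j" for x
  proof -
    \<comment> \<open>The modified policy is admissible as \<open>x \<le> j \<le> m\<close>, so
      \<open>R_H p\<close> bounds its critical price as well.\<close>
    have "?d x \<in> policies p"
      using assms(16,17) that by (auto simp: policies_def states_def)
    then show ?thesis using crit_price_le_R_H assms(15,17) order_trans by blast
  qed
  have "mono_on {0..j} ?\<eta>"
  proof (rule mono_onI)
    fix x y assume *: "x \<in> {0..j}" "y \<in> {0..j}" "x \<le> y"
    obtain c where "c > 0" "?\<eta> y - ?\<eta> x = c * (real y - real x) * (R - crit_price p (?d x) j)"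
      using diff[of x y] * by auto
    moreover have "0 \<le> c * (real y - real x) * (R - crit_price p (?d x) j)"
      using * crit[of x] \<open>c > 0\<close> by (intro mult_nonneg_nonneg) auto
    ultimately show "?\<eta> x \<le> ?\<eta> y" by simp
  qed
  moreover have "strict_mono_on {0..j} ?\<eta>" if ne: "\<forall>x\<in>{0..j}. R \<noteq> crit_price p (?d x) j"
  proof (rule strict_mono_onI)
    fix x y assume *: "x \<in> {0..j}" "y \<in> {0..j}" "x < y"
    obtain c where "c > 0" "?\<eta> y - ?\<eta> x = c * (real y - real x) * (R - crit_price p (?d x) j)"
      using diff[of x y] * by auto
    moreover have "0 < c * (real y - real x) * (R - crit_price p (?d x) j)"
      using * crit[of x] bspec[OF ne *(1)] \<open>c > 0\<close> by (intro mult_pos_pos) auto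
    ultimately show "?\<eta> x < ?\<eta> y" by simp
  qed
  ultimately show ?thesis by blast
qed

end
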